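(* Let $(\Omega, \mathcal{F}, \mu)$ be a finite measure space and let $V$ and $W$ be complete (Hausdorff) locally convex spaces over the same field $\mathbb{K} = \mathbb{R}$ or $\mathbb{C}$. Let $T \colon \mathcal{D}(T) \subseteq V \to W$ be a closed linear operator defined on a linear subspace $\mathcal{D}(T)$ of $V$, and suppose that both $u \colon \Omega \to V$ and $T u \colon \Omega \to W$ are Bochner integrable with respect to $\mu$ (where $u(\omega) \in \mathcal{D}(T)$ and $(Tu)(\omega) = T(u(\omega))$ for $\mu$-a.e. $\omega \in \Omega$). Then, for every $A \in \mathcal{F}$, $$\int_{A} u \, \mathrm{d}\mu \in \mathcal{D}(T) \quad \text{and} \quad \int_{A} T u \, \mathrm{d}\mu = T \int_{A} u \, \mathrm{d}\mu .$$
   Context: Standing assumptions: $0 < \mu(\Omega) < \infty$; locally convex spaces are assumed Hausdorff. The topologies of $V$ and $W$ are generated by families $\mathcal{P}$ and $\mathcal{Q}$ of continuous seminorms on $V$ and $W$ respectively. Completeness means that every Cauchy net converges. Closed operator: a linear operator $T \colon \mathcal{D}(T) \subseteq V \to W$ is closed if its graph $\{ (v, Tv) \in V \oplus W \mid v \in \mathcal{D}(T) \}$ is a closed subspace of $V \oplus W$, where $V \oplus W$ carries the topology generated by the seminorms $(v,w) \mapsto p(v) + q(w)$, $p \in \mathcal{P}$, $q \in \mathcal{Q}$. Equivalently: whenever $(v_j)_j$ is a net in $\mathcal{D}(T)$ converging in $V$ to some $v$ such that $(T v_j)_j$ converges in $W$ to some $w$, it follows that $v \in \mathcal{D}(T)$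 and $w = Tv$. Simple functions: $s \colon \Omega \to V$ is simple if there is a partition of $\Omega$ into finitely many sets $E_1, \dots, E_K \in \mathcal{F}$ such that $s$ is constant on each $E_k$. Writing $s = \sum_{k=1}^K v_k \mathbf{1}_{E_k}$, with $v_k \in V$ and $\mathbf{1}_{E}$ the indicator function of $E$, its integral over $A \in \mathcal{F}$ is $\int_A s \, \mathrm{d}\mu := \sum_{k=1}^K v_k \, \mu(A \cap E_k) \in V$. Bochner convergence: a net or sequence of measurable functions $u_j \colon \Omega \to V$ converges to $u \colon \Omega \to V$ in the Bochner sense if, for all $p \in \mathcal{P}$, $p(u_j - u) \to 0$ $\mu$-a.e. and $\int_\Omega p(u_j - u) \, \mathrm{d}\mu \to 0$. A function $u \colon \Omega \to V$ is Bochner approximable if there exists a sequence $(s_n)_{n \in \mathbb{N}}$ of simple functions $s_n \colon \Omega \to V$ that converges to $u$ in the Bochner sense. In this situation $u$ is Bochner integrable if, for each $A \in \mathcal{F}$, $\left(\int_A s_n \, \mathrm{d}\mu\right)_n$ converges in $V$, and its Bochner integral over $A$ is $\int_A u \, \mathrm{d}\mu := \lim_{n \to \infty} \int_A s_n \, \mathrm{d}\mu$; this is independent of the choice of the approximating sequence. The same definitions apply to $W$ with $\mathcal{Q}$ in place of $\mathcal{P}$. *)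

theory Defs
  imports "HOL-Analysis.Analysis"
begin

definition is_seminorm :: "('k::real_normed_field \<Rightarrow> 'v::ab_group_add \<Rightarrow> 'v) \<Rightarrow> ('v \<Rightarrow> real) \<Rightarrow> bool" where
  "is_seminorm scl p \<longleftrightarrow>
     (\<forall>x. 0 \<le> p x) \<and>
     (\<forall>c x. p (scl c x) = norm c * p x) \<and>
     (\<forall>x y. p (x + y) \<le> p x + p y)"

(* A Hausdorff locally convex space over the field 'k, with a generating family P of seminorms.
   The library has no class of complex vector spaces, so the scalar multiplication is explicit.
   By the theorems of Frobenius/Gelfand-Mazur the instances of real_normed_field are exactly the
   copies of the reals and of the complex numbers with their usual absolute value.
   The uniformity is the one induced by the seminorms; the class uniform_space ties the topology
   to it, so the topology is the one generated by P (see open_iff_seminorms), and the library's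
   "complete (UNIV :: 'v set)" says that every proper Cauchy filter, equivalently every
   Cauchy net, converges (see cauchy_filter_iff_seminorms).  Hausdorff is the class t2_space. *)
locale locally_convex_space = vector_space scl
  for scl :: "'k::real_normed_field \<Rightarrow> 'v::{ab_group_add, uniform_space, t2_space} \<Rightarrow> 'v" +
  fixes P :: "('v \<Rightarrow> real) set"
  assumes seminorms: "p \<in> P \<Longrightarrow> is_seminorm scl p"
    and uniformity_seminorms:
      "uniformity = (INF p\<in>P. INF e\<in>{0<..}. principal {(x, y). p (x - y) < e})"
begin

lemma eventually_uniformity_seminorms:
  "eventually R uniformity \<longleftrightarrow>
     (\<exists>F e. finite F \<and> F \<subseteq> P \<and> 0 < e \<and> (\<forall>x y. (\<forall>p\<in>F. p (x - y) < e) \<longrightarrow> R (x, y)))"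
proof -
  let ?U = "\<lambda>z. {(x, y). fst z (x - y) < snd z}"
  have eq: "uniformity = (INF z\<in>P \<times> {0<..}. principal (?U z))"
  proof (rule antisym)
    show "uniformity \<le> (INF z\<in>P \<times> {0<..}. principal (?U z))"
      unfolding uniformity_seminorms
    proof (rule INF_greatest)
      fix z :: "('v \<Rightarrow> real) \<times> real" assume z: "z \<in> P \<times> {0<..}"
      then show "(INF p\<in>P. INF e\<in>{0<..}. principal {(x, y). p (x - y) < e}) \<le> principal (?U z)"
        by (intro INF_lower2[of "fst z"] INF_lower2[of "snd z"]) auto
    qed
    show "(INF z\<in>P \<times> {0<..}. principal (?U z)) \<le> uniformity"
      unfolding uniformity_seminorms
    proof (intro INF_greatest)
      fix p :: "'v \<Rightarrow> real" and e :: real assume "p \<in> P" "e \<in> {0<..}"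
      then show "(INF z\<in>P \<times> {0<..}. principal (?U z)) \<le> principal {(x, y). p (x - y) < e}"
        by (intro INF_lower2[of "(p, e)"]) auto
    qed
  qed
  show ?thesis
  proof
    assume "eventually R uniformity"
    then have "\<exists>X\<subseteq>P \<times> {0<..}. finite X \<and> eventually R (INF z\<in>X. principal (?U z))"
      unfolding eq by (rule eventually_INF[THEN iffD1])
    then obtain X where X: "finite X" "X \<subseteq> P \<times> {0<..}"
      "eventually R (INF z\<in>X. principal (?U z))"
      by blast
    then have R: "R (x, y)" if "\<forall>z\<in>X. fst z (x - y) < snd z" for x y
      using that by (auto simp: INF_principal_finite eventually_principal)
    define e where "e = Min (insert 1 (snd ` X))"
    have "0 < e" using X unfolding e_def by (subst Min_gr_iff) auto
    moreover have "e \<le> snd z" if "z \<in> X" for z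
      using X that unfolding e_def by (intro Min_le) auto
    ultimately have "0 < e \<and> (\<forall>x y. (\<forall>p\<in>fst ` X. p (x - y) < e) \<longrightarrow> R (x, y))"
      by (metis R image_eqI less_le_trans)
    moreover have "finite (fst ` X)" "fst ` X \<subseteq> P" using X by auto
    ultimately show "\<exists>F e. finite F \<and> F \<subseteq> P \<and> 0 < e \<and>
        (\<forall>x y. (\<forall>p\<in>F. p (x - y) < e) \<longrightarrow> R (x, y))" by blast
  next
    assume "\<exists>F e. finite F \<and> F \<subseteq> P \<and> 0 < e \<and> (\<forall>x y. (\<forall>p\<in>F. p (x - y) < e) \<longrightarrow> R (x, y))"
    then obtain F e where F: "finite F" "F \<subseteq> P" "0 < e"
      and R: "\<And>x y. (\<forall>p\<in>F. p (x - y) < e) \<Longrightarrow> R (x, y)" by blast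
    have "eventually (\<lambda>(x, y). p (x - y) < e) uniformity" if "p \<in> F" for p
      unfolding eq using F that
      by (intro eventually_INF1[of "(p, e)"]) (auto simp: eventually_principal)
    then have "eventually (\<lambda>z. \<forall>p\<in>F. case z of (x, y) \<Rightarrow> p (x - y) < e) uniformity"
      using F by (simp add: eventually_ball_finite_distrib)
    then show "eventually R uniformity"
      by (rule eventually_mono) (auto intro: R)
  qed
qed

lemma open_iff_seminorms:
  "open U \<longleftrightarrow>
     (\<forall>x\<in>U. \<exists>F e. finite F \<and> F \<subseteq> P \<and> 0 < e \<and> {y. \<forall>p\<in>F. p (x - y) < e} \<subseteq> U)"
proof -
  have "(\<forall>a b. (\<forall>p\<in>F. p (a - b) < e) \<longrightarrow> a = x \<longrightarrow> b \<in> U) \<longleftrightarrow> {y. \<forall>p\<in>F. p (x - y) < e} \<subseteq> U"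
    for x F and e :: real by auto
  then show ?thesis
    unfolding open_uniformity eventually_uniformity_seminorms by simp
qed

lemma cauchy_filter_iff_seminorms:
  "cauchy_filter (filtermap x F) \<longleftrightarrow>
     (\<forall>p\<in>P. \<forall>e>0. eventually (\<lambda>(i, j). p (x i - x j) < e) (F \<times>\<^sub>F F))"
proof -
  have "filtermap x F \<times>\<^sub>F filtermap x F = filtermap (map_prod x x) (F \<times>\<^sub>F F)"
    by (simp add: prod_filtermap1 prod_filtermap2 filtermap_filtermap map_prod_def case_prod_unfold
        comp_def)
  then show ?thesis
    unfolding cauchy_filter_def uniformity_seminorms le_INF_iff le_principal
    by (simp add: eventually_filtermap case_prod_unfold Ball_def)
qed

end

(* A linear operator with domain D is a function of which only the values on D matter. The direct
   sum carries the library's product topology, generated by the seminorms (v, w) \<mapsto> p v + q w. *)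
definition closed_linear_operator ::
    "('k::real_normed_field \<Rightarrow> 'v::{ab_group_add, topological_space} \<Rightarrow> 'v) \<Rightarrow>
     ('k \<Rightarrow> 'w::{ab_group_add, topological_space} \<Rightarrow> 'w) \<Rightarrow> 'v set \<Rightarrow> ('v \<Rightarrow> 'w) \<Rightarrow> bool" where
  "closed_linear_operator scaleV scaleW D T \<longleftrightarrow>
     module.subspace scaleV D \<and>
     (\<forall>x\<in>D. \<forall>y\<in>D. T (x + y) = T x + T y) \<and>
     (\<forall>c. \<forall>x\<in>D. T (scaleV c x) = scaleW c (T x)) \<and>
     closed {(v, T v) | v. v \<in> D}"

(* The sum does not depend on the partition on whose members s is constant; here it is the one
   into the level sets of s. *)
definition simple_lcs_integral ::
    "'a measure \<Rightarrow> ('k::real_normed_field \<Rightarrow> 'v::ab_group_add \<Rightarrow> 'v) \<Rightarrow> 'a set \<Rightarrow> ('a \<Rightarrow> 'v) \<Rightarrow> 'v" where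
  "simple_lcs_integral M scl A s =
     (\<Sum>v\<in>s ` space M. scl (of_real (measure M (A \<inter> {\<omega>\<in>space M. s \<omega> = v}))) v)"

(* If each u j is simple, the first condition makes p (u j - u) equal a.e. to a measurable function,
   and nn_integral is invariant under a.e. equality without measurability conditions. Hence it
   is the integral with respect to the completed measure. *)
definition bochner_converges ::
    "'a measure \<Rightarrow> ('v::ab_group_add \<Rightarrow> real) set \<Rightarrow> (nat \<Rightarrow> 'a \<Rightarrow> 'v) \<Rightarrow> ('a \<Rightarrow> 'v) \<Rightarrow> bool" where
  "bochner_converges M P u\<^sub>j u \<longleftrightarrow>
     (\<forall>p\<in>P. (AE \<omega> in M. (\<lambda>j. p (u\<^sub>j j \<omega> - u \<omega>)) \<longlonglongrightarrow> 0) \<and>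
            (\<lambda>j. \<integral>\<^sup>+\<omega>. ennreal (p (u\<^sub>j j \<omega> - u \<omega>)) \<partial>M) \<longlonglongrightarrow> 0)"

definition bochner_approximates ::
    "'a measure \<Rightarrow> ('v::ab_group_add \<Rightarrow> real) set \<Rightarrow> (nat \<Rightarrow> 'a \<Rightarrow> 'v) \<Rightarrow> ('a \<Rightarrow> 'v) \<Rightarrow> bool" where
  "bochner_approximates M P s u \<longleftrightarrow>
     (\<forall>n. simple_function M (s n)) \<and> bochner_converges M P s u"

definition bochner_integrable ::
    "'a measure \<Rightarrow> ('k::real_normed_field \<Rightarrow> 'v::{ab_group_add, topological_space} \<Rightarrow> 'v) \<Rightarrow>
     ('v \<Rightarrow> real) set \<Rightarrow> ('a \<Rightarrow> 'v) \<Rightarrow> bool" where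
  "bochner_integrable M scl P u \<longleftrightarrow>
     (\<exists>s. bochner_approximates M P s u \<and>
          (\<forall>A\<in>sets M. convergent (\<lambda>n. simple_lcs_integral M scl A (s n))))"

(* The limit does not depend on the approximating sequence, by
   p (\<integral>s - \<integral>t) \<le> \<integral>p (s - u) + \<integral>p (u - t) for simple s, t and the Hausdorff property. *)
definition bochner_integral ::
    "'a measure \<Rightarrow> ('k::real_normed_field \<Rightarrow> 'v::{ab_group_add, topological_space} \<Rightarrow> 'v) \<Rightarrow>
     ('v \<Rightarrow> real) set \<Rightarrow> 'a set \<Rightarrow> ('a \<Rightarrow> 'v) \<Rightarrow> 'v" where
  "bochner_integral M scl P A u =
     (THE x. \<exists>s. bochner_approximates M P s u \<and>
                 (\<lambda>n. simple_lcs_integral M scl A (s n)) \<longlonglongrightarrow> x)"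

end

theory Submission
  imports Defs
begin

text \<open>
  The graph \<open>G\<close> of \<open>T\<close> is a closed linear subspace of the direct sum, and \<open>h = (u, Tu)\<close>
  takes values in \<open>G\<close> almost everywhere. The claim says that the integral of \<open>h\<close> over \<open>A\<close> lies
  in \<open>G\<close>. The usual argument separates a point from \<open>G\<close> by the Hahn--Banach theorem; the proof
  below is elementary instead, and replaces the approximating simple functions by simple functions
  with values in \<open>G\<close>.

  Let \<open>(s, t)\<close> be a simple function close to \<open>h\<close>, in the sense that the integral of
  \<open>r ((s, t) - h)\<close> is small, where \<open>r\<close> is the sum of any finitely many of the given seminorms. On
  each level set \<open>E\<close> of \<open>(s, t)\<close>, with value \<open>k\<close>, choose a point \<open>\<omega>\<close> with \<open>h \<omega> \<in> G\<close> at which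
  \<open>r (k - h \<omega>)\<close> is, up to a small error, the smallest possible on \<open>E\<close>. Replacing the value \<open>k\<close> by
  \<open>h \<omega>\<close> then costs on \<open>E\<close> at most the integral of \<open>r ((s, t) - h)\<close> over \<open>E\<close>, up to the error
  (\<open>near_optimal_selection\<close>). The new simple function has values in \<open>G\<close>, so its integral is in \<open>G\<close>
  by linearity, and it is close to the integral of \<open>(s, t)\<close> (\<open>seminorm_cell_sum_le\<close>), hence close
  to the integral of \<open>h\<close>. As \<open>G\<close> is closed, the integral of \<open>h\<close> belongs to \<open>G\<close>.

  The functions \<open>p (s - u)\<close> need not be measurable, and for arbitrary functions the integral
  of a sum can exceed the sum of the integrals. As almost everywhere limits of
  measurable functions they are however measurable for the completed measure
  (\<open>bochner_approximates_measurable\<close>), for which the integral is additive.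
\<close>

section \<open>Seminorms and the topology\<close>

context locally_convex_space
begin

lemma seminorm_nonneg: "p \<in> P \<Longrightarrow> 0 \<le> p x"
  using seminorms unfolding is_seminorm_def by blast

lemma seminorm_scale: "p \<in> P \<Longrightarrow> p (scl c x) = norm c * p x"
  using seminorms unfolding is_seminorm_def by blast

lemma seminorm_triangle: "p \<in> P \<Longrightarrow> p (x + y) \<le> p x + p y"
  using seminorms unfolding is_seminorm_def by blast

lemma seminorm_zero: "p \<in> P \<Longrightarrow> p 0 = 0"
  using seminorm_scale[of p 0 0] by simp

lemma seminorm_minus: "p \<in> P \<Longrightarrow> p (- x) = p x"
  using seminorm_scale[of p "-1" x] by simp

lemma seminorm_commute: "p \<in> P \<Longrightarrow> p (x - y) = p (y - x)"
  using seminorm_minus[of p "x - y"] by simp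

lemma seminorm_diff_triangle: "p \<in> P \<Longrightarrow> p (x - z) \<le> p (x - y) + p (y - z)"
  using seminorm_triangle[of p "x - y" "y - z"] by simp

lemma seminorm_sum: "p \<in> P \<Longrightarrow> p (\<Sum>i\<in>I. f i) \<le> (\<Sum>i\<in>I. p (f i))"
proof (induction I rule: infinite_finite_induct)
  case (insert i I)
  then show ?case
    using seminorm_triangle[of p "f i" "\<Sum>i\<in>I. f i"] by simp
qed (auto simp: seminorm_zero)

lemma seminorm_eventually_less:
  assumes "(X \<longlongrightarrow> x) H" "p \<in> P" "0 < e"
  shows "eventually (\<lambda>i. p (X i - x) < e) H"
proof -
  have "eventually (\<lambda>y. p (x - y) < e) (nhds x)"
    unfolding eventually_nhds_uniformity eventually_uniformity_seminorms
    using assms(2,3) by (intro exI[of _ "{p}"] exI[of _ e]) auto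
  then have "eventually (\<lambda>i. p (x - X i) < e) H"
    using assms(1) unfolding filterlim_iff by blast
  then show ?thesis
    using seminorm_commute[OF assms(2)] by simp
qed

lemma seminorms_separate_points:
  assumes "\<And>p. p \<in> P \<Longrightarrow> p (x - y) = 0"
  shows "x = y"
proof (rule ccontr)
  assume "x \<noteq> y"
  then obtain U where U: "open U" "x \<in> U" "y \<notin> U"
    using hausdorff[of x y] by blast
  then obtain F e where F: "F \<subseteq> P" "0 < e" "{z. \<forall>p\<in>F. p (x - z) < e} \<subseteq> U"
    unfolding open_iff_seminorms by blast
  then have "y \<in> U"
    using assms F(1,2) by (intro subsetD[OF F(3)] CollectI ballI) (metis subsetD)
  with U show False by simp
qed

end

text \<open>
  Membership in a closed set of pairs can be tested one neighbourhood box at a time, which is how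
  closedness of the graph is used.
\<close>

lemma closed_prod_memI:
  assumes V: "locally_convex_space scaleV P" and W: "locally_convex_space scaleW Q"
    and "closed C"
    and approx: "\<And>F F' e. finite F \<Longrightarrow> F \<subseteq> P \<Longrightarrow> finite F' \<Longrightarrow> F' \<subseteq> Q \<Longrightarrow> 0 < e \<Longrightarrow>
      \<exists>(a, b)\<in>C. (\<forall>p\<in>F. p (x - a) < e) \<and> (\<forall>q\<in>F'. q (y - b) < (e::real))"
  shows "(x, y) \<in> C"
proof (rule ccontr)
  assume "(x, y) \<notin> C"
  then have "open (- C)" "(x, y) \<in> - C"
    using \<open>closed C\<close> by auto
  then obtain U U' where U: "open U" "open U'" "(x, y) \<in> U \<times> U'" "U \<times> U' \<subseteq> - C"
    by (rule open_prod_elim)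
  obtain F e where F: "finite F" "F \<subseteq> P" "0 < e" "{z. \<forall>p\<in>F. p (x - z) < e} \<subseteq> U"
    using locally_convex_space.open_iff_seminorms[OF V, THEN iffD1, OF U(1)] U(3) by fast
  obtain F' e' where F': "finite F'" "F' \<subseteq> Q" "0 < e'" "{z. \<forall>p\<in>F'. p (y - z) < e'} \<subseteq> U'"
    using locally_convex_space.open_iff_seminorms[OF W, THEN iffD1, OF U(2)] U(3) by fast
  obtain a b where ab: "(a, b) \<in> C" "\<forall>p\<in>F. p (x - a) < min e e'" "\<forall>q\<in>F'. q (y - b) < min e e'"
    using approx[OF F(1,2) F'(1,2), of "min e e'"] F(3) F'(3) by fastforce
  then have "a \<in> U" "b \<in> U'"
    using F(4) F'(4) by auto
  with U(4) ab(1) show False by auto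
qed

section \<open>Integrals of simple functions\<close>

text \<open>
  Simple functions with different level sets can be compared only over a common partition. The
  level sets of a third simple function \<open>z\<close> serve as that partition: below, \<open>z\<close> will be a pair of
  simple functions.
\<close>

lemma (in locally_convex_space) simple_lcs_integral_eq_cell_sum:
  assumes "finite_measure M" and z: "simple_function M z" and A: "A \<in> sets M"
    and s: "\<And>\<omega>. \<omega> \<in> space M \<Longrightarrow> s \<omega> = f (z \<omega>)"
  shows "simple_lcs_integral M scl A s =
    (\<Sum>k\<in>z ` space M. scl (of_real (measure M (A \<inter> {\<omega>\<in>space M. z \<omega> = k}))) (f k))"
proof -
  interpret finite_measure M by fact
  let ?Z = "z ` space M"
  let ?E = "\<lambda>k. A \<inter> {\<omega>\<in>space M. z \<omega> = k}"
  have fin: "finite ?Z"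
    using z by (rule simple_functionD)
  have "{\<omega>\<in>space M. z \<omega> = k} \<in> sets M" for k
    using simple_functionD(2)[OF z, of "{k}"] by (auto simp: vimage_def Int_def conj_commute)
  then have E: "?E k \<in> sets M" for k
    using A by blast
  have img: "s ` space M = f ` ?Z"
    using s by (force simp: image_iff)
  have cell: "scl (of_real (measure M (A \<inter> {\<omega>\<in>space M. s \<omega> = v}))) v =
      (\<Sum>k\<in>{k\<in>?Z. f k = v}. scl (of_real (measure M (?E k))) (f k))" for v
  proof -
    have "A \<inter> {\<omega>\<in>space M. s \<omega> = v} = (\<Union>k\<in>{k\<in>?Z. f k = v}. ?E k)"
      using s by auto
    also have "measure M \<dots> = (\<Sum>k\<in>{k\<in>?Z. f k = v}. measure M (?E k))"
      using fin E by (intro finite_measure_finite_Union) (auto simp: disjoint_family_on_def)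
    finally show ?thesis
      by (simp add: scale_sum_left)
  qed
  show ?thesis
    unfolding simple_lcs_integral_def img cell using fin by (intro sum.group) auto
qed

text \<open>
  The triangle inequality for the integral over \<open>A\<close> of the simple function \<open>\<omega> \<mapsto> a (z \<omega>)\<close>.
\<close>

lemma (in locally_convex_space) seminorm_cell_sum_le:
  assumes "finite_measure M" and z: "simple_function M z" and A: "A \<in> sets M" and p: "p \<in> P"
  shows "ennreal (p (\<Sum>k\<in>z ` space M. scl (of_real (measure M (A \<inter> {\<omega>\<in>space M. z \<omega> = k}))) (a k)))
    \<le> (\<integral>\<^sup>+\<omega>. ennreal (p (a (z \<omega>))) \<partial>M)"
proof -
  interpret finite_measure M by fact
  let ?Z = "z ` space M"
  let ?E = "\<lambda>k. {\<omega>\<in>space M. z \<omega> = k}"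
  have E: "?E k \<in> sets M" for k
    using simple_functionD(2)[OF z, of "{k}"] by (auto simp: vimage_def Int_def conj_commute)
  have "p (\<Sum>k\<in>?Z. scl (of_real (measure M (A \<inter> ?E k))) (a k))
      \<le> (\<Sum>k\<in>?Z. p (scl (of_real (measure M (A \<inter> ?E k))) (a k)))"
    using p by (rule seminorm_sum)
  also have "\<dots> \<le> (\<Sum>k\<in>?Z. p (a k) * measure M (?E k))"
    using E seminorm_nonneg[OF p]
    by (intro sum_mono)
      (auto simp: seminorm_scale[OF p] mult.commute intro!: mult_left_mono finite_measure_mono)
  finally have "ennreal (p (\<Sum>k\<in>?Z. scl (of_real (measure M (A \<inter> ?E k))) (a k)))
      \<le> ennreal (\<Sum>k\<in>?Z. p (a k) * measure M (?E k))"
    by (rule ennreal_leI)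
  also have "\<dots> = (\<Sum>k\<in>?Z. ennreal (p (a k)) * emeasure M (?E k))"
    using seminorm_nonneg[OF p]
    by (subst sum_ennreal[symmetric]) (auto simp: emeasure_eq_measure ennreal_mult')
  also have "\<dots> = integral\<^sup>S M (\<lambda>\<omega>. ennreal (p (a (z \<omega>))))"
    by (rule simple_function_partition[symmetric])
      (auto intro: z simple_function_compose1[OF z, of "\<lambda>k. ennreal (p (a k))"])
  also have "\<dots> = (\<integral>\<^sup>+\<omega>. ennreal (p (a (z \<omega>))) \<partial>M)"
    by (intro nn_integral_eq_simple_integral[symmetric]
        simple_function_compose1[OF z, of "\<lambda>k. ennreal (p (a k))"])
  finally show ?thesis .
qed

section \<open>Approximating sequences\<close>

text \<open>
  Completeness of the measure makes the value of a limit on a null set irrelevant to measurability.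
\<close>

lemma (in complete_measure) borel_measurable_AE_limit:
  fixes f :: "nat \<Rightarrow> 'a \<Rightarrow> real"
  assumes f: "\<And>i. f i \<in> borel_measurable M"
    and lim: "AE x in M. (\<lambda>i. f i x) \<longlonglongrightarrow> g x"
  shows "g \<in> borel_measurable M"
proof (rule measurableI)
  let ?l = "\<lambda>x. lim (\<lambda>i. f i x)"
  fix B :: "real set" assume "B \<in> sets borel"
  have "?l -` B \<inter> space M \<in> sets M"
    using borel_measurable_lim_metric[of f M] f \<open>B \<in> sets borel\<close> by (rule_tac measurable_sets) auto
  moreover have "AE x in M. x \<in> ?l -` B \<inter> space M \<longleftrightarrow> x \<in> g -` B \<inter> space M"
    using lim by eventually_elim (auto dest: limI)
  ultimately show "g -` B \<inter> space M \<in> sets M"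
    using in_sets_AE by blast
qed auto

context locally_convex_space
begin

text \<open>
  The function in question is the almost everywhere limit, as \<open>k\<close> grows, of the simple functions
  \<open>p (s n - s k)\<close>.
\<close>

lemma bochner_approximates_measurable:
  assumes s: "bochner_approximates M P s u" and p: "p \<in> P"
  shows "(\<lambda>\<omega>. p (s n \<omega> - u \<omega>)) \<in> borel_measurable (completion M)"
proof -
  have sf: "simple_function M (s n)" for n
    using s unfolding bochner_approximates_def by blast
  have "AE \<omega> in M. (\<lambda>k. p (s k \<omega> - u \<omega>)) \<longlonglongrightarrow> 0"
    using s p unfolding bochner_approximates_def bochner_converges_def by blast
  then have "AE \<omega> in M. (\<lambda>k. p (s n \<omega> - s k \<omega>)) \<longlonglongrightarrow> p (s n \<omega> - u \<omega>)"
  proof eventually_elim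
    case (elim \<omega>)
    have "norm (p (s n \<omega> - s k \<omega>) - p (s n \<omega> - u \<omega>)) \<le> p (s k \<omega> - u \<omega>)" for k
      using seminorm_diff_triangle[OF p, of "s n \<omega>" "s k \<omega>" "u \<omega>"]
        seminorm_diff_triangle[OF p, of "s n \<omega>" "u \<omega>" "s k \<omega>"]
        seminorm_commute[OF p, of "s k \<omega>" "u \<omega>"] by auto
    with elim have "(\<lambda>k. p (s n \<omega> - s k \<omega>) - p (s n \<omega> - u \<omega>)) \<longlonglongrightarrow> 0"
      by (rule_tac Lim_null_comparison) (auto intro: always_eventually)
    then show ?case
      by (rule LIM_zero_cancel)
  qed
  then have "AE \<omega> in completion M. (\<lambda>k. p (s n \<omega> - s k \<omega>)) \<longlonglongrightarrow> p (s n \<omega> - u \<omega>)"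
    by (rule AE_completion)
  moreover have "(\<lambda>\<omega>. p (s n \<omega> - s k \<omega>)) \<in> borel_measurable (completion M)" for k
    using sf by (intro measurable_completion borel_measurable_simple_function
        simple_function_compose2[where h = "\<lambda>x y. p (x - y)"])
  ultimately show ?thesis
    by (rule_tac completion.borel_measurable_AE_limit)
qed

lemma bochner_approximates_integral_tendsto:
  "bochner_approximates M P s u \<Longrightarrow> p \<in> P \<Longrightarrow>
    (\<lambda>n. \<integral>\<^sup>+\<omega>. ennreal (p (s n \<omega> - u \<omega>)) \<partial>M) \<longlonglongrightarrow> 0"
  unfolding bochner_approximates_def bochner_converges_def by blast

lemma seminorm_simple_lcs_integral_diff_le:
  assumes "finite_measure M" "A \<in> sets M" and p: "p \<in> P"
    and s: "bochner_approximates M P s u" and t: "bochner_approximates M P t u"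
  shows "ennreal (p (simple_lcs_integral M scl A (s n) - simple_lcs_integral M scl A (t n)))
    \<le> (\<integral>\<^sup>+\<omega>. ennreal (p (s n \<omega> - u \<omega>)) \<partial>M) + (\<integral>\<^sup>+\<omega>. ennreal (p (t n \<omega> - u \<omega>)) \<partial>M)"
proof -
  let ?z = "\<lambda>\<omega>. (s n \<omega>, t n \<omega>)"
  have z: "simple_function M ?z"
    using s t unfolding bochner_approximates_def by blast
  have [measurable]: "(\<lambda>\<omega>. p (s n \<omega> - u \<omega>)) \<in> borel_measurable (completion M)"
    "(\<lambda>\<omega>. p (t n \<omega> - u \<omega>)) \<in> borel_measurable (completion M)"
    using s t p by (auto intro: bochner_approximates_measurable)
  have "simple_lcs_integral M scl A (s n) - simple_lcs_integral M scl A (t n) =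
      (\<Sum>k\<in>?z ` space M. scl (of_real (measure M (A \<inter> {\<omega>\<in>space M. ?z \<omega> = k}))) (fst k - snd k))"
    by (simp add: simple_lcs_integral_eq_cell_sum[OF assms(1) z assms(2), of "s n" fst]
        simple_lcs_integral_eq_cell_sum[OF assms(1) z assms(2), of "t n" snd]
        scale_right_diff_distrib sum_subtractf)
  then have "ennreal (p (simple_lcs_integral M scl A (s n) - simple_lcs_integral M scl A (t n)))
      \<le> (\<integral>\<^sup>+\<omega>. ennreal (p (s n \<omega> - t n \<omega>)) \<partial>M)"
    using seminorm_cell_sum_le[OF assms(1) z assms(2) p, of "\<lambda>k. fst k - snd k"] by simp
  also have "\<dots> \<le> (\<integral>\<^sup>+\<omega>. ennreal (p (s n \<omega> - u \<omega>)) + ennreal (p (t n \<omega> - u \<omega>)) \<partial>M)"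
  proof (rule nn_integral_mono)
    fix \<omega>
    have "p (s n \<omega> - t n \<omega>) \<le> p (s n \<omega> - u \<omega>) + p (t n \<omega> - u \<omega>)"
      using seminorm_diff_triangle[OF p, of "s n \<omega>" "t n \<omega>" "u \<omega>"]
        seminorm_commute[OF p, of "t n \<omega>" "u \<omega>"] by simp
    then show "ennreal (p (s n \<omega> - t n \<omega>)) \<le> ennreal (p (s n \<omega> - u \<omega>)) + ennreal (p (t n \<omega> - u \<omega>))"
      using seminorm_nonneg[OF p] by (simp flip: ennreal_plus)
  qed
  also have "\<dots> = (\<integral>\<^sup>+\<omega>. ennreal (p (s n \<omega> - u \<omega>)) + ennreal (p (t n \<omega> - u \<omega>)) \<partial>completion M)"
    by (rule nn_integral_completion[symmetric])
  also have "\<dots> = (\<integral>\<^sup>+\<omega>. ennreal (p (s n \<omega> - u \<omega>)) \<partial>completion M)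
      + (\<integral>\<^sup>+\<omega>. ennreal (p (t n \<omega> - u \<omega>)) \<partial>completion M)"
    by (rule nn_integral_add) measurable
  finally show ?thesis
    by (simp add: nn_integral_completion)
qed

lemma bochner_integral_unique:
  assumes "finite_measure M" "A \<in> sets M"
    and s: "bochner_approximates M P s u" "(\<lambda>n. simple_lcs_integral M scl A (s n)) \<longlonglongrightarrow> x"
    and t: "bochner_approximates M P t u" "(\<lambda>n. simple_lcs_integral M scl A (t n)) \<longlonglongrightarrow> y"
  shows "x = y"
proof (rule seminorms_separate_points)
  fix p assume p: "p \<in> P"
  let ?I = "\<lambda>n. simple_lcs_integral M scl A (s n)" and ?J = "\<lambda>n. simple_lcs_integral M scl A (t n)"
  have "p (x - y) \<le> e" if "0 < e" for e
  proof -
    have "(\<lambda>n. (\<integral>\<^sup>+\<omega>. ennreal (p (s n \<omega> - u \<omega>)) \<partial>M) + (\<integral>\<^sup>+\<omega>. ennreal (p (t n \<omega> - u \<omega>)) \<partial>M))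
        \<longlonglongrightarrow> 0 + 0"
      using s t p by (intro tendsto_add bochner_approximates_integral_tendsto)
    then have "eventually (\<lambda>n. (\<integral>\<^sup>+\<omega>. ennreal (p (s n \<omega> - u \<omega>)) \<partial>M) +
        (\<integral>\<^sup>+\<omega>. ennreal (p (t n \<omega> - u \<omega>)) \<partial>M) < ennreal (e / 3)) sequentially"
      using \<open>0 < e\<close> by (intro order_tendstoD) auto
    moreover have "eventually (\<lambda>n. p (?I n - x) < e / 3) sequentially"
      "eventually (\<lambda>n. p (?J n - y) < e / 3) sequentially"
      using p \<open>0 < e\<close>
      by (auto intro: seminorm_eventually_less[OF s(2)] seminorm_eventually_less[OF t(2)]
          simp del: less_divide_eq_numeral1)
    ultimately have "eventually (\<lambda>n. p (x - y) \<le> e) sequentially"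
    proof eventually_elim
      case (elim n)
      have "ennreal (p (?I n - ?J n)) < ennreal (e / 3)"
        using seminorm_simple_lcs_integral_diff_le[OF assms(1,2) p s(1) t(1), of n] elim(1)
        by (rule le_less_trans)
      then have "p (?I n - ?J n) < e / 3"
        using seminorm_nonneg[OF p] by (simp add: ennreal_less_iff)
      with elim show ?case
        using seminorm_diff_triangle[OF p, of x y "?I n"]
          seminorm_diff_triangle[OF p, of "?I n" y "?J n"]
          seminorm_commute[OF p, of x "?I n"] by simp
    qed
    then show ?thesis by simp
  qed
  then have "p (x - y) \<le> 0"
    by (rule field_le_epsilon[of _ 0, simplified])
  then show "p (x - y) = 0"
    using seminorm_nonneg[OF p, of "x - y"] by simp
qed

lemma bochner_integral_eqI:
  assumes "finite_measure M" "A \<in> sets M"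
    and "bochner_approximates M P s u" "(\<lambda>n. simple_lcs_integral M scl A (s n)) \<longlonglongrightarrow> x"
  shows "bochner_integral M scl P A u = x"
  unfolding bochner_integral_def
  using assms bochner_integral_unique[OF assms(1,2)] by (intro the_equality) blast+

end

section \<open>Replacing values by nearby values of the integrand\<close>

text \<open>
  Think of \<open>c k \<omega>\<close> as the cost of replacing the value \<open>k\<close> of the simple function \<open>z\<close> by the value of
  another function at \<open>\<omega>\<close>. On each level set of \<open>z\<close> a point whose cost is nearly the infimum
  over the level set does at most slightly worse than the average, so selecting one such point
  for each value does not increase the total cost noticeably. Only points in a set of full measure
  need to be selected; this is where values in the graph will be obtained from values that
  are in the graph almost everywhere.
\<close>

lemma near_optimal_selection:
  fixes c :: "'b \<Rightarrow> 'a \<Rightarrow> real"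
  assumes "finite_measure M" and pos: "0 < measure M (space M)"
    and good: "AE \<omega> in M. Good \<omega>"
    and c_nonneg: "\<And>k \<omega>. 0 \<le> c k \<omega>"
    and meas: "(\<lambda>\<omega>. c (z \<omega>) \<omega>) \<in> borel_measurable (completion M)"
    and "0 < e"
  obtains pt where "\<And>k. Good (pt k)"
    and "(\<integral>\<^sup>+\<omega>. ennreal (c (z \<omega>) (pt (z \<omega>))) \<partial>M) \<le> (\<integral>\<^sup>+\<omega>. ennreal (c (z \<omega>) \<omega>) \<partial>M) + ennreal e"
proof -
  interpret finite_measure M by fact
  define d where "d = e / measure M (space M)"
  have "0 < d"
    using pos \<open>0 < e\<close> by (simp add: d_def)
  \<comment> \<open>A level set that is contained in the exceptional null set has no suitable point of
    its own; any good point serves for it.\<close>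
  have "\<exists>\<omega>. Good \<omega>"
  proof (rule ccontr)
    assume "\<nexists>\<omega>. Good \<omega>"
    with good have "AE \<omega> in M. False" by simp
    then have "emeasure M (space M) = 0"
      by (simp add: AE_iff_measurable[OF _ refl])
    with pos show False by (simp add: measure_def)
  qed
  then obtain \<omega>0 where \<omega>0: "Good \<omega>0" ..
  have "\<exists>x. Good x \<and> (\<forall>\<omega>. Good \<omega> \<and> z \<omega> = k \<longrightarrow> c k x \<le> c k \<omega> + d)" for k
  proof (cases "\<exists>\<omega>. Good \<omega> \<and> z \<omega> = k")
    case True
    let ?C = "c k ` {\<omega>. Good \<omega> \<and> z \<omega> = k}"
    have "?C \<noteq> {}" "bdd_below ?C"
      using True c_nonneg by (auto intro: bdd_belowI[of _ 0])
    then obtain x where "Good x" "z x = k" "c k x < Inf ?C + d"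
      using cInf_lessD[of ?C "Inf ?C + d"] \<open>0 < d\<close> by auto
    moreover have "Inf ?C \<le> c k \<omega>" if "Good \<omega>" "z \<omega> = k" for \<omega>
      using that \<open>bdd_below ?C\<close> by (auto intro: cInf_lower)
    ultimately show ?thesis by fastforce
  qed (use \<omega>0 in blast)
  then obtain pt where pt: "\<And>k. Good (pt k)"
    "\<And>k \<omega>. Good \<omega> \<Longrightarrow> z \<omega> = k \<Longrightarrow> c k (pt k) \<le> c k \<omega> + d"
    by metis
  have "(\<integral>\<^sup>+\<omega>. ennreal (c (z \<omega>) (pt (z \<omega>))) \<partial>M) \<le> (\<integral>\<^sup>+\<omega>. ennreal (c (z \<omega>) \<omega>) + ennreal d \<partial>M)"
  proof (rule nn_integral_mono_AE)
    show "AE \<omega> in M. ennreal (c (z \<omega>) (pt (z \<omega>))) \<le> ennreal (c (z \<omega>) \<omega>) + ennreal d"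
      using good
    proof eventually_elim
      case (elim \<omega>)
      then show ?case
        using pt(2)[of \<omega> "z \<omega>"] c_nonneg \<open>0 < d\<close> by (simp flip: ennreal_plus)
    qed
  qed
  also have "\<dots> = (\<integral>\<^sup>+\<omega>. ennreal (c (z \<omega>) \<omega>) + ennreal d \<partial>completion M)"
    by (rule nn_integral_completion[symmetric])
  also have "\<dots> = (\<integral>\<^sup>+\<omega>. ennreal (c (z \<omega>) \<omega>) \<partial>completion M) + (\<integral>\<^sup>+\<omega>. ennreal d \<partial>completion M)"
    using meas by (intro nn_integral_add) auto
  also have "(\<integral>\<^sup>+\<omega>. ennreal d \<partial>completion M) = ennreal d * emeasure M (space M)"
    by (simp add: nn_integral_completion)
  also have "\<dots> = ennreal e"
    using pos \<open>0 < d\<close> by (simp add: emeasure_eq_measure d_def flip: ennreal_mult')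
  finally show thesis
    using pt(1) by (intro that[of pt]) (simp_all add: nn_integral_completion)
qed

section \<open>Closed operators commute with the integral\<close>

lemma closed_linear_operator_sum:
  assumes "closed_linear_operator scaleV scaleW D T" "module scaleV" "module scaleW"
    and d: "\<And>i. i \<in> I \<Longrightarrow> d i \<in> D"
  shows "(\<Sum>i\<in>I. scaleV (m i) (d i)) \<in> D \<and>
    T (\<Sum>i\<in>I. scaleV (m i) (d i)) = (\<Sum>i\<in>I. scaleW (m i) (T (d i)))"
proof -
  interpret V: module scaleV by fact
  interpret W: module scaleW by fact
  have D: "V.subspace D"
    and add: "\<And>x y. x \<in> D \<Longrightarrow> y \<in> D \<Longrightarrow> T (x + y) = T x + T y"
    and scale: "\<And>c x. x \<in> D \<Longrightarrow> T (scaleV c x) = scaleW c (T x)"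
    using assms(1) unfolding closed_linear_operator_def by auto
  have "T 0 = 0"
    using scale[of 0 0] V.subspace_0[OF D] by simp
  then show ?thesis
    using d
    by (induction I rule: infinite_finite_induct)
      (auto simp: add scale V.subspace_0[OF D] V.subspace_add[OF D] V.subspace_scale[OF D])
qed

theorem theorem1p1:
  fixes M :: "'a measure"
    and scaleV :: "'k::real_normed_field \<Rightarrow> 'v::{ab_group_add, uniform_space, t2_space} \<Rightarrow> 'v"
    and scaleW :: "'k \<Rightarrow> 'w::{ab_group_add, uniform_space, t2_space} \<Rightarrow> 'w"
    and P :: "('v \<Rightarrow> real) set"
    and Q :: "('w \<Rightarrow> real) set"
    and D :: "'v set"
    and T :: "'v \<Rightarrow> 'w"
    and u :: "'a \<Rightarrow> 'v"
    and Tu :: "'a \<Rightarrow> 'w"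
  assumes "finite_measure M"
    and "0 < measure M (space M)"
    and "locally_convex_space scaleV P"
    and "locally_convex_space scaleW Q"
    and "complete (UNIV :: 'v set)"
    and "complete (UNIV :: 'w set)"
    and "closed_linear_operator scaleV scaleW D T"
    and "AE \<omega> in M. u \<omega> \<in> D \<and> Tu \<omega> = T (u \<omega>)"
    and "bochner_integrable M scaleV P u"
    and "bochner_integrable M scaleW Q Tu"
  shows "\<forall>A\<in>sets M.
           bochner_integral M scaleV P A u \<in> D \<and>
           bochner_integral M scaleW Q A Tu = T (bochner_integral M scaleV P A u)"
proof
  fix A assume A: "A \<in> sets M"
  note M = \<open>finite_measure M\<close>
  interpret V: locally_convex_space scaleV P by fact
  interpret W: locally_convex_space scaleW Q by fact
  obtain s x where s: "bochner_approximates M P s u"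
    and x: "(\<lambda>n. simple_lcs_integral M scaleV A (s n)) \<longlonglongrightarrow> x"
    using assms(9) A unfolding bochner_integrable_def convergent_def by blast
  obtain t y where t: "bochner_approximates M Q t Tu"
    and y: "(\<lambda>n. simple_lcs_integral M scaleW A (t n)) \<longlonglongrightarrow> y"
    using assms(10) A unfolding bochner_integrable_def convergent_def by blast
  let ?I = "\<lambda>n. simple_lcs_integral M scaleV A (s n)"
  let ?J = "\<lambda>n. simple_lcs_integral M scaleW A (t n)"
  have "(x, y) \<in> {(v, T v) | v. v \<in> D}"
  proof (rule closed_prod_memI[OF assms(3,4)])
    show "closed {(v, T v) | v. v \<in> D}"
      using assms(7) unfolding closed_linear_operator_def by blast
  next
    fix F F' and e :: real
    assume F: "finite F" "F \<subseteq> P" and F': "finite F'" "F' \<subseteq> Q" and "0 < e"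
    let ?z = "\<lambda>n \<omega>. (s n \<omega>, t n \<omega>)"
    \<comment> \<open>The seminorm \<open>r\<close> of the pair \<open>k - (u \<omega>, Tu \<omega>)\<close>; it bounds each seminorm that defines the box.\<close>
    define c where "c k \<omega> = (\<Sum>p\<in>F. p (fst k - u \<omega>)) + (\<Sum>q\<in>F'. q (snd k - Tu \<omega>))" for k \<omega>
    have nonnegF: "0 \<le> p v" if "p \<in> F" for p v
      using that F V.seminorm_nonneg by blast
    have nonnegF': "0 \<le> q w" if "q \<in> F'" for q w
      using that F' W.seminorm_nonneg by blast
    have c_nonneg: "0 \<le> c k \<omega>" for k \<omega>
      unfolding c_def using nonnegF nonnegF' by (intro add_nonneg_nonneg sum_nonneg)
    have le_cV: "p (fst k - u \<omega>) \<le> c k \<omega>" if "p \<in> F" for p k \<omega>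
    proof -
      have "p (fst k - u \<omega>) \<le> (\<Sum>p\<in>F. p (fst k - u \<omega>))"
        using that F nonnegF by (intro member_le_sum) auto
      moreover have "0 \<le> (\<Sum>q\<in>F'. q (snd k - Tu \<omega>))"
        using nonnegF' by (intro sum_nonneg)
      ultimately show ?thesis by (simp add: c_def)
    qed
    have le_cW: "q (snd k - Tu \<omega>) \<le> c k \<omega>" if "q \<in> F'" for q k \<omega>
    proof -
      have "q (snd k - Tu \<omega>) \<le> (\<Sum>q\<in>F'. q (snd k - Tu \<omega>))"
        using that F' nonnegF' by (intro member_le_sum) auto
      moreover have "0 \<le> (\<Sum>p\<in>F. p (fst k - u \<omega>))"
        using nonnegF by (intro sum_nonneg)
      ultimately show ?thesis by (simp add: c_def)
    qed
    have measV: "(\<lambda>\<omega>. p (s n \<omega> - u \<omega>)) \<in> borel_measurable (completion M)" if "p \<in> F" for p n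
      using that F s by (auto intro: V.bochner_approximates_measurable)
    have measW: "(\<lambda>\<omega>. q (t n \<omega> - Tu \<omega>)) \<in> borel_measurable (completion M)" if "q \<in> F'" for q n
      using that F' t by (auto intro: W.bochner_approximates_measurable)
    have c_meas: "(\<lambda>\<omega>. c (?z n \<omega>) \<omega>) \<in> borel_measurable (completion M)" for n
      unfolding c_def using measV measW by (auto intro!: borel_measurable_add borel_measurable_sum)
    have c_integral: "(\<integral>\<^sup>+\<omega>. ennreal (c (?z n \<omega>) \<omega>) \<partial>M) =
        (\<Sum>p\<in>F. \<integral>\<^sup>+\<omega>. ennreal (p (s n \<omega> - u \<omega>)) \<partial>M)
        + (\<Sum>q\<in>F'. \<integral>\<^sup>+\<omega>. ennreal (q (t n \<omega> - Tu \<omega>)) \<partial>M)" for n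
    proof -
      have "(\<integral>\<^sup>+\<omega>. ennreal (c (?z n \<omega>) \<omega>) \<partial>M) =
          (\<integral>\<^sup>+\<omega>. (\<Sum>p\<in>F. ennreal (p (s n \<omega> - u \<omega>))) + (\<Sum>q\<in>F'. ennreal (q (t n \<omega> - Tu \<omega>)))
            \<partial>completion M)"
        using nonnegF nonnegF'
        by (simp add: nn_integral_completion c_def sum_nonneg)
      also have "\<dots> = (\<integral>\<^sup>+\<omega>. (\<Sum>p\<in>F. ennreal (p (s n \<omega> - u \<omega>))) \<partial>completion M)
          + (\<integral>\<^sup>+\<omega>. (\<Sum>q\<in>F'. ennreal (q (t n \<omega> - Tu \<omega>))) \<partial>completion M)"
        using measV measW by (intro nn_integral_add borel_measurable_sum) auto
      also have "\<dots> = (\<Sum>p\<in>F. \<integral>\<^sup>+\<omega>. ennreal (p (s n \<omega> - u \<omega>)) \<partial>completion M)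
          + (\<Sum>q\<in>F'. \<integral>\<^sup>+\<omega>. ennreal (q (t n \<omega> - Tu \<omega>)) \<partial>completion M)"
        using measV measW by (intro arg_cong2[where f = "(+)"] nn_integral_sum) auto
      finally show ?thesis
        by (simp add: nn_integral_completion)
    qed
    have "(\<lambda>n. \<integral>\<^sup>+\<omega>. ennreal (c (?z n \<omega>) \<omega>) \<partial>M) \<longlonglongrightarrow> (\<Sum>p\<in>F. 0) + (\<Sum>q\<in>F'. 0)"
      unfolding c_integral using F F' s t
      by (intro tendsto_add tendsto_sum V.bochner_approximates_integral_tendsto
          W.bochner_approximates_integral_tendsto) auto
    then have "eventually (\<lambda>n. (\<integral>\<^sup>+\<omega>. ennreal (c (?z n \<omega>) \<omega>) \<partial>M) < ennreal (e / 4)) sequentially"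
      using \<open>0 < e\<close> by (intro order_tendstoD) auto
    moreover have "eventually (\<lambda>n. \<forall>p\<in>F. p (?I n - x) < e / 2) sequentially"
      using F \<open>0 < e\<close>
      by (intro eventually_ball_finite ballI V.seminorm_eventually_less[OF x]) auto
    moreover have "eventually (\<lambda>n. \<forall>q\<in>F'. q (?J n - y) < e / 2) sequentially"
      using F' \<open>0 < e\<close>
      by (intro eventually_ball_finite ballI W.seminorm_eventually_less[OF y]) auto
    ultimately have "eventually (\<lambda>n. (\<integral>\<^sup>+\<omega>. ennreal (c (?z n \<omega>) \<omega>) \<partial>M) < ennreal (e / 4) \<and>
        (\<forall>p\<in>F. p (?I n - x) < e / 2) \<and> (\<forall>q\<in>F'. q (?J n - y) < e / 2)) sequentially"
      by eventually_elim blast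
    from eventually_happens'[OF sequentially_bot this]
    obtain n where n: "(\<integral>\<^sup>+\<omega>. ennreal (c (?z n \<omega>) \<omega>) \<partial>M) < ennreal (e / 4)"
      "\<forall>p\<in>F. p (?I n - x) < e / 2" "\<forall>q\<in>F'. q (?J n - y) < e / 2"
      by blast
    obtain pt where good: "\<And>k. u (pt k) \<in> D \<and> Tu (pt k) = T (u (pt k))"
      and pt: "(\<integral>\<^sup>+\<omega>. ennreal (c (?z n \<omega>) (pt (?z n \<omega>))) \<partial>M)
        \<le> (\<integral>\<^sup>+\<omega>. ennreal (c (?z n \<omega>) \<omega>) \<partial>M) + ennreal (e / 4)"
      using near_optimal_selection[OF M assms(2,8), of c "?z n" "e / 4"] c_nonneg c_meas \<open>0 < e\<close>
      by auto
    have "(\<integral>\<^sup>+\<omega>. ennreal (c (?z n \<omega>) (pt (?z n \<omega>))) \<partial>M) \<le> ennreal (e / 4) + ennreal (e / 4)"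
      using pt n(1) by (meson add_right_mono less_imp_le order_trans)
    also have "\<dots> = ennreal (e / 2)"
      using \<open>0 < e\<close> by (simp flip: ennreal_plus)
    finally have cost: "(\<integral>\<^sup>+\<omega>. ennreal (c (?z n \<omega>) (pt (?z n \<omega>))) \<partial>M) \<le> ennreal (e / 2)" .
    have z: "simple_function M (?z n)"
      using s t unfolding bochner_approximates_def by blast
    let ?m = "\<lambda>k. of_real (measure M (A \<inter> {\<omega>\<in>space M. ?z n \<omega> = k})) :: 'k"
    let ?a = "\<Sum>k\<in>?z n ` space M. scaleV (?m k) (u (pt k))"
    let ?b = "\<Sum>k\<in>?z n ` space M. scaleW (?m k) (Tu (pt k))"
    have "?a \<in> D \<and> T ?a = (\<Sum>k\<in>?z n ` space M. scaleW (?m k) (T (u (pt k))))"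
      using good
      by (intro closed_linear_operator_sum[OF assms(7)] V.module_axioms W.module_axioms) auto
    then have "(?a, ?b) \<in> {(v, T v) | v. v \<in> D}"
      using good by simp
    moreover have "p (x - ?a) < e" if "p \<in> F" for p
    proof -
      have p: "p \<in> P" using that F by blast
      have "?I n - ?a = (\<Sum>k\<in>?z n ` space M. scaleV (?m k) (fst k - u (pt k)))"
        by (simp add: V.simple_lcs_integral_eq_cell_sum[OF M z A, of "s n" fst]
            V.scale_right_diff_distrib sum_subtractf)
      then have "ennreal (p (?I n - ?a)) \<le> (\<integral>\<^sup>+\<omega>. ennreal (p (fst (?z n \<omega>) - u (pt (?z n \<omega>)))) \<partial>M)"
        using V.seminorm_cell_sum_le[OF M z A p, of "\<lambda>k. fst k - u (pt k)"] by simp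
      also have "\<dots> \<le> (\<integral>\<^sup>+\<omega>. ennreal (c (?z n \<omega>) (pt (?z n \<omega>))) \<partial>M)"
        by (intro nn_integral_mono ennreal_leI le_cV that)
      also note cost
      finally have "p (?I n - ?a) \<le> e / 2"
        using \<open>0 < e\<close> by (simp add: ennreal_le_iff)
      moreover have "p (x - ?I n) < e / 2"
        using bspec[OF n(2) that] V.seminorm_commute[OF p, of x "?I n"] by simp
      ultimately show ?thesis
        using V.seminorm_diff_triangle[OF p, of x ?a "?I n"] by simp
    qed
    moreover have "q (y - ?b) < e" if "q \<in> F'" for q
    proof -
      have q: "q \<in> Q" using that F' by blast
      have "?J n - ?b = (\<Sum>k\<in>?z n ` space M. scaleW (?m k) (snd k - Tu (pt k)))"
        by (simp add: W.simple_lcs_integral_eq_cell_sum[OF M z A, of "t n" snd]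
            W.scale_right_diff_distrib sum_subtractf)
      then have "ennreal (q (?J n - ?b)) \<le> (\<integral>\<^sup>+\<omega>. ennreal (q (snd (?z n \<omega>) - Tu (pt (?z n \<omega>)))) \<partial>M)"
        using W.seminorm_cell_sum_le[OF M z A q, of "\<lambda>k. snd k - Tu (pt k)"] by simp
      also have "\<dots> \<le> (\<integral>\<^sup>+\<omega>. ennreal (c (?z n \<omega>) (pt (?z n \<omega>))) \<partial>M)"
        by (intro nn_integral_mono ennreal_leI le_cW that)
      also note cost
      finally have "q (?J n - ?b) \<le> e / 2"
        using \<open>0 < e\<close> by (simp add: ennreal_le_iff)
      moreover have "q (y - ?J n) < e / 2"
        using bspec[OF n(3) that] W.seminorm_commute[OF q, of y "?J n"] by simp
      ultimately show ?thesis
        using W.seminorm_diff_triangle[OF q, of y ?b "?J n"] by simp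
    qed
    ultimately show "\<exists>(a, b)\<in>{(v, T v) | v. v \<in> D}.
        (\<forall>p\<in>F. p (x - a) < e) \<and> (\<forall>q\<in>F'. q (y - b) < e)"
      by (intro bexI[of _ "(?a, ?b)"]) auto
  qed
  moreover have "bochner_integral M scaleV P A u = x" "bochner_integral M scaleW Q A Tu = y"
    using V.bochner_integral_eqI[OF M A s x] W.bochner_integral_eqI[OF M A t y] .
  ultimately show "bochner_integral M scaleV P A u \<in> D \<and>
      bochner_integral M scaleW Q A Tu = T (bochner_integral M scaleV P A u)"
    by auto
qed

end
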